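(* Let $(R,B)$ be a commutative fusion ring and let $\phi\in\mathrm{Aut}(R,B)$ have order $2$. If $\phi$ is fixed-point-free, then $\phi(x)=x^\ast$ for all $x\in B$.
   Context: A fusion ring $(R,B)$ is an associative unital ring $R$, free as a $\mathbb{Z}$-module with a distinguished finite basis $B=\{b_0=1_R,b_1,\ldots,b_n\}$, together with an anti-involution (duality) $b_i\mapsto b_i^\ast=b_{i^\ast}$ of $B$, extended linearly to an antiautomorphism of $R$, such that $b_ib_j=\sum_k c_{ij}^k b_k$ with $c_{ij}^k\in\mathbb{Z}_{\geq0}$ and $c_{ij}^0=\delta_{i,j^\ast}$. It is commutative if $R$ is a commutative ring. $\mathrm{Aut}(R,B)$ is the group of permutations of $B$ whose linear extension to $R$ is a unital ring automorphism. $\phi\in\mathrm{Aut}(R,B)$ is fixed-point-free if $1_R$ is the only element of $B$ fixed by $\phi$. *)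

theory Defs
  imports "HOL-Algebra.Algebra"
begin

definition lincomb :: "('a, 'm) ring_scheme \<Rightarrow> 'a set \<Rightarrow> ('a \<Rightarrow> int) \<Rightarrow> ('a \<Rightarrow> 'a) \<Rightarrow> 'a" where
  "lincomb R B c f = (\<Oplus>\<^bsub>R\<^esub>b\<in>B. [c b] \<cdot>\<^bsub>R\<^esub> f b)"

text \<open>A finite \<open>\<int>\<close>-basis of the additive group of \<open>R\<close>.  Coefficient functions are extensional
  on \<open>B\<close>, so that uniqueness is literal uniqueness of functions.\<close>

definition int_basis :: "('a, 'm) ring_scheme \<Rightarrow> 'a set \<Rightarrow> bool" where
  "int_basis R B \<longleftrightarrow> finite B \<and> B \<subseteq> carrier R \<and>
     (\<forall>x\<in>carrier R. \<exists>!c. c \<in> extensional B \<and> x = lincomb R B c (\<lambda>b. b))"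

definition coord :: "('a, 'm) ring_scheme \<Rightarrow> 'a set \<Rightarrow> 'a \<Rightarrow> 'a \<Rightarrow> int" where
  "coord R B x = (THE c. c \<in> extensional B \<and> x = lincomb R B c (\<lambda>b. b))"

definition lin_ext :: "('a, 'm) ring_scheme \<Rightarrow> 'a set \<Rightarrow> ('a \<Rightarrow> 'a) \<Rightarrow> 'a \<Rightarrow> 'a" where
  "lin_ext R B f x = lincomb R B (coord R B x) f"

definition opposite_ring :: "('a, 'm) ring_scheme \<Rightarrow> ('a, 'm) ring_scheme" where
  "opposite_ring R = R\<lparr>mult := \<lambda>x y. y \<otimes>\<^bsub>R\<^esub> x\<rparr>"

text \<open>The structure constant \<open>c\<^sub>i\<^sub>j\<^sup>k\<close> is \<open>coord R B (b\<^sub>i \<otimes> b\<^sub>j) b\<^sub>k\<close>.  The function \<open>dual\<close> is only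
  relevant on \<open>B\<close>; an antiautomorphism of \<open>R\<close> is an isomorphism from \<open>R\<close> to its opposite.\<close>

locale fusion_ring = ring R for R :: "('a, 'm) ring_scheme" (structure) +
  fixes B :: "'a set" and dual :: "'a \<Rightarrow> 'a"
  assumes basis: "int_basis R B"
    and one_in_basis: "\<one> \<in> B"
    and dual_closed: "b \<in> B \<Longrightarrow> dual b \<in> B"
    and dual_dual: "b \<in> B \<Longrightarrow> dual (dual b) = b"
    and dual_antiautomorphism: "lin_ext R B dual \<in> ring_iso R (opposite_ring R)"
    and structure_const_nonneg:
      "\<lbrakk>a \<in> B; b \<in> B; d \<in> B\<rbrakk> \<Longrightarrow> 0 \<le> coord R B (a \<otimes> b) d"
    and structure_const_one:
      "\<lbrakk>a \<in> B; b \<in> B\<rbrakk> \<Longrightarrow> coord R B (a \<otimes> b) \<one> = (if a = dual b then 1 else 0)"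

locale commutative_fusion_ring = fusion_ring R B dual + cring R
  for R :: "('a, 'm) ring_scheme" (structure) and B dual

definition fusion_aut :: "('a, 'm) ring_scheme \<Rightarrow> 'a set \<Rightarrow> ('a \<Rightarrow> 'a) monoid" where
  "fusion_aut R B =
     BijGroup B\<lparr>carrier := {\<phi> \<in> Bij B. lin_ext R B \<phi> \<in> ring_iso R R}\<rparr>"

definition fixed_point_free :: "('a, 'm) ring_scheme \<Rightarrow> 'a set \<Rightarrow> ('a \<Rightarrow> 'a) \<Rightarrow> bool" where
  "fixed_point_free R B \<phi> \<longleftrightarrow> {b \<in> B. \<phi> b = b} = {\<one>\<^bsub>R\<^esub>}"

text \<open>\<open>fusion_aut R B\<close> is a group, so that the order \<open>group.ord\<close> of its elements is meaningful.\<close>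

context fusion_ring
begin

lemma finite_B: "finite B" and B_carrier: "B \<subseteq> carrier R"
  using basis by (auto simp: int_basis_def)

lemma lincomb_closed: "f \<in> B \<rightarrow> carrier R \<Longrightarrow> lincomb R B c f \<in> carrier R"
  unfolding lincomb_def by (intro finsum_closed) (auto intro: add.int_pow_closed)

lemma lincomb_cong:
  assumes "f \<in> B \<rightarrow> carrier R" "\<And>b. b \<in> B \<Longrightarrow> c b = c' b" "\<And>b. b \<in> B \<Longrightarrow> f b = g b"
  shows "lincomb R B c f = lincomb R B c' g"
proof -
  have "g \<in> B \<rightarrow> carrier R" using assms by (metis (no_types, lifting) Pi_cong)
  with assms show ?thesis
    unfolding lincomb_def by (intro finsum_cong') (auto intro: add.int_pow_closed)
qed

lemma coord:
  assumes "x \<in> carrier R"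
  shows "coord R B x \<in> extensional B" "x = lincomb R B (coord R B x) (\<lambda>b. b)"
proof -
  have "\<exists>!c. c \<in> extensional B \<and> x = lincomb R B c (\<lambda>b. b)"
    using basis assms by (simp add: int_basis_def)
  from theI'[OF this] show "coord R B x \<in> extensional B" "x = lincomb R B (coord R B x) (\<lambda>b. b)"
    unfolding coord_def by auto
qed

lemma coord_lincomb:
  assumes "b \<in> B"
  shows "coord R B (lincomb R B c (\<lambda>b. b)) b = c b"
proof -
  let ?x = "lincomb R B c (\<lambda>b. b)"
  have x: "?x \<in> carrier R" by (rule lincomb_closed) (use B_carrier in auto)
  have "?x = lincomb R B (restrict c B) (\<lambda>b. b)"
    by (rule lincomb_cong) (use B_carrier in auto)
  moreover have "\<exists>!c. c \<in> extensional B \<and> ?x = lincomb R B c (\<lambda>b. b)"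
    using basis x by (simp add: int_basis_def)
  ultimately have "coord R B ?x = restrict c B"
    using coord[OF x] by (metis restrict_extensional)
  with assms show ?thesis by simp
qed

lemma lincomb_permute:
  assumes p: "bij_betw p B B" and f: "f \<in> B \<rightarrow> carrier R"
  shows "lincomb R B c (\<lambda>b. f (p b)) = lincomb R B (\<lambda>b. c (inv_into B p b)) f"
proof -
  have pB: "p ` B = B" and inj: "inj_on p B" using p by (auto simp: bij_betw_def)
  have "lincomb R B (\<lambda>b. c (inv_into B p b)) f
      = (\<Oplus>b\<in>p ` B. [c (inv_into B p b)] \<cdot> f b)"
    by (simp add: lincomb_def pB)
  also have "\<dots> = (\<Oplus>b\<in>B. [c (inv_into B p (p b))] \<cdot> f (p b))"
    by (rule finsum_reindex) (use f pB inj in \<open>auto intro!: add.int_pow_closed\<close>)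
  also have "\<dots> = lincomb R B c (\<lambda>b. f (p b))"
    unfolding lincomb_def
    by (intro finsum_cong') (use f pB inj in \<open>auto intro!: add.int_pow_closed\<close>)
  finally show ?thesis ..
qed

lemma lin_ext_closed: "p \<in> Bij B \<Longrightarrow> lin_ext R B p x \<in> carrier R"
  unfolding lin_ext_def by (rule lincomb_closed) (use B_carrier Bij_imp_funcset in blast)

lemma lin_ext_id: "x \<in> carrier R \<Longrightarrow> lin_ext R B (\<lambda>b\<in>B. b) x = x"
  unfolding lin_ext_def
  by (subst (2) coord(2), assumption) (rule lincomb_cong, use B_carrier in auto)

lemma lin_ext_compose:
  assumes p: "p \<in> Bij B" and q: "q \<in> Bij B"
  shows "lin_ext R B (compose B p q) x = lin_ext R B p (lin_ext R B q x)"
proof -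
  have pc: "p \<in> B \<rightarrow> carrier R" using B_carrier Bij_imp_funcset[OF p] by auto
  have qB: "q \<in> B \<rightarrow> B" "bij_betw q B B" using q by (auto simp: Bij_def bij_betw_imp_funcset)
  let ?c = "\<lambda>b. coord R B x (inv_into B q b)"
  have "lin_ext R B q x = lincomb R B ?c (\<lambda>b. b)"
    using lincomb_permute[OF qB(2), of "\<lambda>b. b" "coord R B x"] B_carrier by (auto simp: lin_ext_def)
  then have "lin_ext R B p (lin_ext R B q x) = lincomb R B ?c p"
    unfolding lin_ext_def[of R B p] using pc by (auto intro!: lincomb_cong simp: coord_lincomb)
  also have "\<dots> = lincomb R B (coord R B x) (\<lambda>b. p (q b))"
    using lincomb_permute[OF qB(2) pc] by simp
  also have "\<dots> = lin_ext R B (compose B p q) x"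
    unfolding lin_ext_def by (rule lincomb_cong) (use pc qB in \<open>auto simp: compose_def\<close>)
  finally show ?thesis ..
qed

theorem group_fusion_aut: "group (fusion_aut R B)"
proof -
  let ?A = "{\<phi> \<in> Bij B. lin_ext R B \<phi> \<in> ring_iso R R}"
  have "subgroup ?A (BijGroup B)"
  proof (rule subgroup.intro)
    show "?A \<subseteq> carrier (BijGroup B)" by (auto simp: BijGroup_def)
  next
    fix p q assume pq: "p \<in> ?A" "q \<in> ?A"
    have "lin_ext R B p \<circ> lin_ext R B q \<in> ring_iso R R"
      using pq by (auto intro: ring_iso_set_trans)
    moreover have "lin_ext R B p \<circ> lin_ext R B q = lin_ext R B (compose B p q)"
      using pq by (auto simp: lin_ext_compose)
    ultimately show "p \<otimes>\<^bsub>BijGroup B\<^esub> q \<in> ?A"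
      using pq by (auto simp: BijGroup_def compose_Bij)
  next
    have "lin_ext R B (\<lambda>b\<in>B. b) \<in> ring_iso R R"
      using ring_iso_restrict[OF ring_iso_set_refl, of "lin_ext R B (\<lambda>b\<in>B. b)"]
      by (simp add: lin_ext_id)
    then show "\<one>\<^bsub>BijGroup B\<^esub> \<in> ?A" by (simp add: BijGroup_def id_Bij)
  next
    fix p assume p: "p \<in> ?A"
    let ?q = "\<lambda>b\<in>B. inv_into B p b"
    have q: "?q \<in> Bij B" using p restrict_inv_into_Bij by blast
    have bij: "bij_betw (lin_ext R B p) (carrier R) (carrier R)"
      using p by (simp add: ring_iso_def)
    have "lin_ext R B ?q y = inv_into (carrier R) (lin_ext R B p) y" if y: "y \<in> carrier R" for y
    proof -
      obtain x where x: "x \<in> carrier R" "y = lin_ext R B p x"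
        using bij y by (auto simp: bij_betw_def)
      have "lin_ext R B ?q y = lin_ext R B (compose B ?q p) x"
        using p q x by (simp add: lin_ext_compose)
      also have "\<dots> = x"
        using p x Bij_compose_restrict_eq[of p B] by (simp add: lin_ext_id)
      finally show ?thesis using x bij by (simp add: bij_betw_def)
    qed
    then have "lin_ext R B ?q \<in> ring_iso R R"
      using ring_iso_restrict[OF ring_iso_set_sym[OF ring_axioms]] p
      by fastforce
    then show "inv\<^bsub>BijGroup B\<^esub> p \<in> ?A"
      using p q by (simp add: inv_BijGroup)
  qed
  then show ?thesis
    unfolding fusion_aut_def by (rule subgroup.subgroup_is_group) (rule group_BijGroup)
qed

end

end

(* For x in B put p = x x* and u = x \<phi>(x). Since R is commutative, p \<phi>(p) = u u*; compare the
   coefficients of 1 modulo 2. The only fixed point of \<phi> in B is 1, so a sum over B of a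
   \<phi>-invariant function has the parity of its term at 1. For p \<phi>(p) the coefficient is the sum of
   p_b p_\<phi>(b), hence odd because p_1 = 1. For u u* it is the sum of (u_b)^2, which has the parity
   of u_1 because \<phi>(u) = u. So u_1 is nonzero, which means \<phi>(x) = x*. *)
theory Submission
  imports Defs "HOL-Library.Z2" "HOL-Library.Disjoint_Sets"
begin

text \<open>The elements \<open>a\<close> and \<open>p a\<close> form pairs with equal values. In
  the two-element field \<open>bit\<close> equal values are opposite, so each pair cancels.\<close>

lemma even_sum_fixed_point_free_involution:
  fixes g :: "'a \<Rightarrow> int"
  assumes "\<And>a. a \<in> A \<Longrightarrow> p a \<in> A" "\<And>a. a \<in> A \<Longrightarrow> p (p a) = a"
    and "\<And>a. a \<in> A \<Longrightarrow> p a \<noteq> a" "\<And>a. a \<in> A \<Longrightarrow> g (p a) = g a"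
  shows "even (\<Sum>a\<in>A. g a)"
proof -
  have "(of_int (\<Sum>a\<in>A. g a) :: bit) = 0"
    unfolding of_int_sum by (rule sum_involution_eq_0[of _ _ p]) (use assms in auto)
  moreover have "(of_int z :: bit) = 1" if "odd z" for z
    using that by (elim oddE) simp
  ultimately show ?thesis by fastforce
qed

context fusion_ring
begin

lemma lincomb_coord: "x \<in> carrier R \<Longrightarrow> lincomb R B (coord R B x) (\<lambda>b. b) = x"
  using coord(2) by simp

lemma lincomb_add:
  assumes "f \<in> B \<rightarrow> carrier R"
  shows "lincomb R B (\<lambda>b. c b + d b) f = lincomb R B c f \<oplus> lincomb R B d f"
proof -
  have "lincomb R B (\<lambda>b. c b + d b) f = (\<Oplus>b\<in>B. [c b] \<cdot> f b \<oplus> [d b] \<cdot> f b)"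
    unfolding lincomb_def
    by (intro finsum_cong') (use assms in \<open>auto intro!: add.int_pow_closed add.int_pow_mult\<close>)
  also have "\<dots> = lincomb R B c f \<oplus> lincomb R B d f"
    unfolding lincomb_def
    by (intro finsum_addf) (use assms in \<open>auto intro!: add.int_pow_closed\<close>)
  finally show ?thesis .
qed

lemma coord_add:
  assumes "x \<in> carrier R" "y \<in> carrier R" "b \<in> B"
  shows "coord R B (x \<oplus> y) b = coord R B x b + coord R B y b"
proof -
  have "x \<oplus> y = lincomb R B (\<lambda>b. coord R B x b + coord R B y b) (\<lambda>b. b)"
    using assms B_carrier by (subst lincomb_add) (auto simp: lincomb_coord)
  then show ?thesis using coord_lincomb[OF assms(3)] by metis
qed

text \<open>Packages additivity so that the fact on integer powers under a group homomorphism yields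
  \<open>coord_add_pow\<close>.\<close>

lemma coord_hom: "b \<in> B \<Longrightarrow> (\<lambda>x. coord R B x b) \<in> hom (add_monoid R) integer_group"
  by (rule homI) (auto simp: coord_add integer_group_def)

lemma coord_add_pow:
  assumes "x \<in> carrier R" "b \<in> B"
  shows "coord R B ([n] \<cdot> x) b = (n :: int) * coord R B x b"
proof -
  interpret h: group_hom "add_monoid R" integer_group "\<lambda>x. coord R B x b"
    using coord_hom[OF assms(2)] by (intro group_hom.intro group_hom_axioms.intro) (auto simp: a_group)
  show ?thesis using h.hom_int_pow[of x n] assms
    by (simp add: add_pow_def)
qed

lemma coord_zero: "b \<in> B \<Longrightarrow> coord R B \<zero> b = 0"
  using coord_add[of \<zero> \<zero> b] by simp

lemma coord_finsum:
  assumes "finite A" "f \<in> A \<rightarrow> carrier R" "b \<in> B"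
  shows "coord R B (finsum R f A) b = (\<Sum>a\<in>A. coord R B (f a) b)"
  using assms(1,2)
  by (induction A rule: finite_induct) (use assms(3) in \<open>simp_all add: coord_zero coord_add\<close>)

text \<open>By distributivity only the basis expansion of \<open>x\<close> matters. With the mirror
  version below, coefficients of products reduce to structure constants.\<close>

lemma coord_mult_expand_left:
  assumes x: "x \<in> carrier R" and y: "y \<in> carrier R" and d: "d \<in> B"
  shows "coord R B (x \<otimes> y) d = (\<Sum>a\<in>B. coord R B x a * coord R B (a \<otimes> y) d)"
proof -
  have "x \<otimes> y = (\<Oplus>a\<in>B. [coord R B x a] \<cdot> a) \<otimes> y"
    using lincomb_coord[OF x] by (simp add: lincomb_def)
  also have "\<dots> = (\<Oplus>a\<in>B. [coord R B x a] \<cdot> a \<otimes> y)"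
    using B_carrier y by (intro finsum_ldistr finite_B) (auto intro!: add.int_pow_closed)
  also have "\<dots> = (\<Oplus>a\<in>B. [coord R B x a] \<cdot> (a \<otimes> y))"
    using B_carrier y by (intro finsum_cong') (auto simp: add_pow_ldistr_int intro!: add.int_pow_closed)
  finally have "x \<otimes> y = (\<Oplus>a\<in>B. [coord R B x a] \<cdot> (a \<otimes> y))" .
  then show ?thesis
    using B_carrier y d
    by (auto simp: coord_finsum finite_B coord_add_pow Pi_def subset_iff intro!: sum.cong add.int_pow_closed)
qed

lemma coord_mult_expand_right:
  assumes x: "x \<in> carrier R" and y: "y \<in> carrier R" and d: "d \<in> B"
  shows "coord R B (x \<otimes> y) d = (\<Sum>b\<in>B. coord R B y b * coord R B (x \<otimes> b) d)"
proof -
  have "x \<otimes> y = x \<otimes> (\<Oplus>b\<in>B. [coord R B y b] \<cdot> b)"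
    using lincomb_coord[OF y] by (simp add: lincomb_def)
  also have "\<dots> = (\<Oplus>b\<in>B. x \<otimes> [coord R B y b] \<cdot> b)"
    using B_carrier x by (intro finsum_rdistr finite_B) (auto intro!: add.int_pow_closed)
  also have "\<dots> = (\<Oplus>b\<in>B. [coord R B y b] \<cdot> (x \<otimes> b))"
    using B_carrier x by (intro finsum_cong') (auto simp: add_pow_rdistr_int intro!: add.int_pow_closed)
  finally have "x \<otimes> y = (\<Oplus>b\<in>B. [coord R B y b] \<cdot> (x \<otimes> b))" .
  then show ?thesis
    using B_carrier x d
    by (auto simp: coord_finsum finite_B coord_add_pow Pi_def subset_iff intro!: sum.cong add.int_pow_closed)
qed

text \<open>Expanding both factors leaves the structure constants at \<open>\<one>\<close>, and
  these vanish except on pairs of mutually dual basis elements.\<close>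

lemma coord_mult_one:
  assumes x: "x \<in> carrier R" and y: "y \<in> carrier R"
  shows "coord R B (x \<otimes> y) \<one> = (\<Sum>b\<in>B. coord R B x b * coord R B y (dual b))"
proof -
  have "coord R B (a \<otimes> y) \<one> = coord R B y (dual a)" if a: "a \<in> B" for a
  proof -
    \<comment> \<open>\<open>structure_const_one\<close> is solved for the left factor, but the sum
      runs over the right one.\<close>
    have "a = dual b \<longleftrightarrow> b = dual a" if "b \<in> B" for b
      using a that dual_dual by metis
    then have "coord R B (a \<otimes> y) \<one> = (\<Sum>b\<in>B. if b = dual a then coord R B y b else 0)"
      using a B_carrier y one_in_basis
      by (subst coord_mult_expand_right) (auto simp: structure_const_one intro!: sum.cong)
    then show ?thesis
      by (simp add: finite_B dual_closed[OF a])
  qed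
  then show ?thesis
    using x y one_in_basis by (simp add: coord_mult_expand_left)
qed

text \<open>By uniqueness of coordinates, those of \<open>a\<close> form the indicator function of
  \<open>a\<close>. The fact \<open>single\<close> serves twice: with the identity to find these
  coordinates, with \<open>f\<close> to evaluate.\<close>

lemma lin_ext_basis:
  assumes f: "f \<in> B \<rightarrow> carrier R" and a: "a \<in> B"
  shows "lin_ext R B f a = f a"
proof -
  have single: "lincomb R B (\<lambda>b. if b = a then 1 else 0) g = g a" if g: "g \<in> B \<rightarrow> carrier R" for g
  proof -
    have "lincomb R B (\<lambda>b. if b = a then 1 else 0) g = (\<Oplus>b\<in>B. if a = b then g b else \<zero>)"
      unfolding lincomb_def
      by (intro finsum_cong') (use g in \<open>auto simp: Pi_iff, simp add: add_pow_def\<close>)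
    then show ?thesis using finsum_singleton[OF a finite_B g] by simp
  qed
  have "coord R B a b = (if b = a then 1 else 0)" if "b \<in> B" for b
    using coord_lincomb[OF that, of "\<lambda>b. if b = a then 1 else 0"] single[of "\<lambda>b. b"] B_carrier
    by (simp add: Pi_iff subset_iff)
  then have "lin_ext R B f a = lincomb R B (\<lambda>b. if b = a then 1 else 0) f"
    unfolding lin_ext_def by (intro lincomb_cong f) auto
  then show ?thesis using single[OF f] by simp
qed

text \<open>Permuting the basis moves coordinates by the inverse permutation, which for an
  involution is \<open>p\<close> itself. Used for both \<open>\<phi>\<close> and
  \<open>dual\<close>.\<close>

lemma coord_lin_ext_involution:
  assumes p: "\<And>b. b \<in> B \<Longrightarrow> p b \<in> B" "\<And>b. b \<in> B \<Longrightarrow> p (p b) = b" and b: "b \<in> B"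
  shows "coord R B (lin_ext R B p x) b = coord R B x (p b)"
proof -
  have bij: "bij_betw p B B"
    by (rule bij_betw_byWitness[where f' = p]) (use p in auto)
  have "inv_into B p b = p b"
    by (rule inv_into_f_eq) (use p b bij in \<open>auto simp: bij_betw_def\<close>)
  moreover have "lin_ext R B p x = lincomb R B (\<lambda>b. coord R B x (inv_into B p b)) (\<lambda>b. b)"
    using lincomb_permute[OF bij, of "\<lambda>b. b" "coord R B x"] B_carrier by (auto simp: lin_ext_def)
  ultimately show ?thesis using coord_lincomb[OF b] by simp
qed

end

context commutative_fusion_ring
begin

text \<open>Order 2 enters here as \<open>\<phi> (\<phi> b) = b\<close> on \<open>B\<close>, free of
  group language.\<close>

lemma fixed_point_free_involution_eq_dual:
  assumes \<phi>: "\<And>b. b \<in> B \<Longrightarrow> \<phi> b \<in> B" "\<And>b. b \<in> B \<Longrightarrow> \<phi> (\<phi> b) = b"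
    and iso: "lin_ext R B \<phi> \<in> ring_iso R R"
    and fpf: "fixed_point_free R B \<phi>"
    and x: "x \<in> B"
  shows "\<phi> x = dual x"
proof -
  let ?F = "lin_ext R B \<phi>" and ?D = "lin_ext R B dual" and ?c = "coord R B"
  have Bc: "b \<in> carrier R" if "b \<in> B" for b using that B_carrier by auto
  have fixed: "\<phi> b = b \<longleftrightarrow> b = \<one>" if "b \<in> B" for b
    using fpf that unfolding fixed_point_free_def by auto
  have FB: "?F b = \<phi> b" and DB: "?D b = dual b" if "b \<in> B" for b
    using that B_carrier \<phi>(1) dual_closed by (auto intro!: lin_ext_basis)
  have F_mult: "?F (a \<otimes> b) = ?F a \<otimes> ?F b" and F_closed: "?F a \<in> carrier R"
    if "a \<in> carrier R" "b \<in> carrier R" for a b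
    using iso that by (auto simp: ring_iso_def ring_hom_mult ring_hom_closed)
  have D_mult: "?D (a \<otimes> b) = ?D b \<otimes> ?D a"
    if "a \<in> carrier R" "b \<in> carrier R" for a b
    using dual_antiautomorphism that by (auto simp: ring_iso_def opposite_ring_def ring_hom_def)
  have cF: "?c (?F z) b = ?c z (\<phi> b)" and cD: "?c (?D z) b = ?c z (dual b)" if "b \<in> B" for z b
    using that \<phi> dual_closed dual_dual by (simp_all add: coord_lin_ext_involution)
  \<comment> \<open>The dual of a basis element is the one whose product with it has coefficient 1
    at \<open>\<one>\<close>. The automorphism keeps that coefficient because \<open>\<phi>\<close>
    fixes \<open>\<one>\<close>.\<close>
  have \<phi>_dual: "\<phi> (dual b) = dual (\<phi> b)" if b: "b \<in> B" for b
  proof -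
    note db = dual_closed[OF b]
    have "?c (\<phi> b \<otimes> \<phi> (dual b)) \<one> = ?c (b \<otimes> dual b) (\<phi> \<one>)"
      using cF[OF one_in_basis, of "b \<otimes> dual b"] b db by (simp add: F_mult Bc FB)
    also have "\<dots> = 1"
      using fixed[OF one_in_basis] b db by (simp add: structure_const_one dual_dual)
    finally have "\<phi> b = dual (\<phi> (dual b))"
      using b db \<phi>(1) by (simp add: structure_const_one split: if_splits)
    then show ?thesis using db \<phi>(1) dual_dual by simp
  qed
  have parity: "even (sum g B) \<longleftrightarrow> even (g \<one>)" if "\<And>b. b \<in> B \<Longrightarrow> g (\<phi> b) = g b" for g :: "'a \<Rightarrow> int"
  proof -
    have "even (sum g (B - {\<one>}))"
      by (rule even_sum_fixed_point_free_involution[of _ \<phi>])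
        (use that \<phi> fixed one_in_basis in \<open>auto, metis\<close>)
    then show ?thesis using finite_B one_in_basis by (simp add: sum.remove)
  qed
  define p where "p = x \<otimes> dual x"
  define u where "u = x \<otimes> \<phi> x"
  note xs = x dual_closed[OF x] \<phi>(1)[OF x] dual_closed[OF \<phi>(1)[OF x]]
  note xc = xs[THEN Bc]
  have pc: "p \<in> carrier R" and uc: "u \<in> carrier R" using xc by (auto simp: p_def u_def)
  have Fp: "?F p = \<phi> x \<otimes> dual (\<phi> x)" using xs xc by (simp add: p_def F_mult FB \<phi>_dual)
  \<comment> \<open>Duality reverses the factors and also exchanges them, so \<open>p\<close> is
    self-dual. In \<open>Fu\<close> the factors are only exchanged, and commutativity restores
    \<open>u\<close>.\<close>
  have Dp: "?D p = p" using xs xc by (simp add: p_def D_mult DB dual_dual)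
  have Fu: "?F u = u" using xs xc \<phi>(2) by (simp add: u_def F_mult FB m_comm)
  have Du: "?D u = dual (\<phi> x) \<otimes> dual x" using xs xc by (simp add: u_def D_mult DB)
  have "p \<otimes> ?F p = u \<otimes> ?D u"
    unfolding Fp Du unfolding p_def u_def using xc by algebra
  then have eq: "?c (p \<otimes> ?F p) \<one> = ?c (u \<otimes> ?D u) \<one>" by simp
  have "?c (p \<otimes> ?F p) \<one> = (\<Sum>b\<in>B. ?c p b * ?c p (\<phi> b))"
  proof -
    \<comment> \<open>The left side is the coefficient of \<open>p\<close> at
      \<open>dual (\<phi> b)\<close>. Self-duality of \<open>p\<close> removes the dual.\<close>
    have "?c (?F p) (dual b) = ?c p (\<phi> b)" if b: "b \<in> B" for b
      using cD[OF \<phi>(1)[OF b], of p] b by (simp add: cF dual_closed \<phi>_dual Dp)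
    then show ?thesis using pc F_closed by (simp add: coord_mult_one)
  qed
  \<comment> \<open>\<open>\<phi>\<close> exchanges the two factors of each term, so the summand is
    invariant. Its value at \<open>\<one>\<close> is the square of the coefficient of
    \<open>x \<otimes> dual x\<close>, which is 1.\<close>
  moreover have "odd (\<Sum>b\<in>B. ?c p b * ?c p (\<phi> b))"
    using parity[of "\<lambda>b. ?c p b * ?c p (\<phi> b)"] \<phi>(2) fixed[OF one_in_basis] one_in_basis xs
    by (simp add: p_def structure_const_one dual_dual mult.commute)
  moreover have "?D u \<in> carrier R" using xc by (simp add: Du)
  \<comment> \<open>The coefficient of the dual of \<open>u\<close> at \<open>dual b\<close> is that
    of \<open>u\<close> at \<open>b\<close>, hence squares.\<close>
  then have "?c (u \<otimes> ?D u) \<one> = (\<Sum>b\<in>B. ?c u b * ?c u b)"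
    using uc by (simp add: coord_mult_one cD dual_closed dual_dual)
  moreover have "even (\<Sum>b\<in>B. ?c u b * ?c u b) \<longleftrightarrow> even (?c u \<one>)"
    using parity[of "\<lambda>b. ?c u b * ?c u b"] cF[of _ u] Fu by simp
  ultimately have "odd (?c u \<one>)" using eq by simp
  \<comment> \<open>The coefficient of \<open>x \<otimes> \<phi> x\<close> at \<open>\<one>\<close>
    is 0 or 1, so odd means 1.\<close>
  then have "x = dual (\<phi> x)"
    using xs by (simp add: u_def structure_const_one split: if_splits)
  then show ?thesis using xs dual_dual by metis
qed

end

theorem corollary3p2:
  fixes R :: "('a, 'm) ring_scheme" and B :: "'a set" and dual \<phi> :: "'a \<Rightarrow> 'a"
  assumes "commutative_fusion_ring R B dual"
    and "\<phi> \<in> carrier (fusion_aut R B)"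
    and "group.ord (fusion_aut R B) \<phi> = 2"
    and "fixed_point_free R B \<phi>"
  shows "\<forall>x\<in>B. \<phi> x = dual x"
proof
  fix x assume x: "x \<in> B"
  interpret commutative_fusion_ring R B dual by (rule assms(1))
  interpret A: group "fusion_aut R B" by (rule group_fusion_aut)
  have bij: "\<phi> \<in> Bij B" and iso: "lin_ext R B \<phi> \<in> ring_iso R R"
    using assms(2) by (auto simp: fusion_aut_def)
  have \<phi>B: "\<phi> b \<in> B" if "b \<in> B" for b
    using Bij_imp_funcset[OF bij] that by auto
  have "\<phi> [^]\<^bsub>fusion_aut R B\<^esub> (2::nat) = \<one>\<^bsub>fusion_aut R B\<^esub>"
    using A.pow_ord_eq_1[OF assms(2)] assms(3) by simp
  \<comment> \<open>Multiplication in \<open>BijGroup\<close> is composition restricted to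
    \<open>B\<close>, and its unit is the restricted identity.\<close>
  then have "compose B \<phi> \<phi> = (\<lambda>b\<in>B. b)"
    using assms(2) bij by (simp add: numeral_2_eq_2) (simp add: fusion_aut_def BijGroup_def)
  then have "\<phi> (\<phi> b) = b" if "b \<in> B" for b
    using that by (metis compose_eq restrict_apply')
  then show "\<phi> x = dual x"
    using fixed_point_free_involution_eq_dual \<phi>B iso assms(4) x by blast
qed

end
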